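(* Let $(X,d)$ be a CAT(0) space and let $(T_\gamma)_{\gamma>0}$ be a family of self-mappings of $X$. Then the following are equivalent: (a) both of the following hold: (i) for all $\gamma>0$, $T_\gamma$ is nonexpansive; (ii) for all $\gamma>0$, all $t\in[0,1)$ and all $x\in X$, $$T_{(1-t)\gamma}\big((1-t)x+tT_\gamma x\big)=T_\gamma x;$$ (b) $(T_\gamma)_{\gamma>0}$ is jointly firmly nonexpansive.
   Context: A metric space $(X,d)$ is geodesic if for any $x,y\in X$ there is a geodesic joining them, i.e. a map $\gamma:[0,1]\to X$ with $\gamma(0)=x$, $\gamma(1)=y$ and $d(\gamma(t),\gamma(t'))=|t-t'|d(x,y)$ for all $t,t'\in[0,1]$. A CAT(0) space is a geodesic space $(X,d)$ such that for any geodesic $\gamma:[0,1]\to X$, any $z\in X$ and any $t\in[0,1]$, $d^2(z,\gamma(t))\le(1-t)d^2(z,\gamma(0))+td^2(z,\gamma(1))-t(1-t)d^2(\gamma(0),\gamma(1))$. (Here $d^2(x,y)$ means $(d(x,y))^2$.) In a CAT(0) space the geodesic $\gamma$ joining $x$ to $y$ is unique, and $(1-t)x+ty$ denotes the point $\gamma(t)$. A mapping $T:X\to X$ is nonexpansive if $d(Tx,Ty)\le d(x,y)$ for all $x,y\in X$. For self-mappings $T,U$ of $X$ and $\lambda,\mu>0$, $T$ and $U$ are $(\lambda,\mu)$-mutually firmly nonexpansive if for all $x,y\in X$ and all $\alpha,\beta\in[0,1]$ such that $(1-\alpha)\lambda=(1-\beta)\mu$, one has $d(Tx,Uy)\le d((1-\alpha)x+\alpha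 Tx,(1-\beta)y+\beta Uy)$. A family $(T_\gamma)_{\gamma>0}$ of self-mappings of $X$ is jointly firmly nonexpansive if for all $\lambda,\mu>0$, $T_\lambda$ and $T_\mu$ are $(\lambda,\mu)$-mutually firmly nonexpansive. *)

theory Defs
  imports "HOL-Analysis.Analysis"
begin

context Metric_space
begin

text \<open>A geodesic is a map on the unit interval, encoded as a total function on the reals whose
  values outside the unit interval are unconstrained.\<close>

definition geodesic_joining :: "(real \<Rightarrow> 'a) \<Rightarrow> 'a \<Rightarrow> 'a \<Rightarrow> bool" where
  "geodesic_joining c x y \<longleftrightarrow>
     c \<in> {0..1} \<rightarrow> M \<and> c 0 = x \<and> c 1 = y \<and>
     (\<forall>t\<in>{0..1}. \<forall>t'\<in>{0..1}. d (c t) (c t') = \<bar>t - t'\<bar> * d x y)"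

text \<open>The point \<open>(1 - t) x + t y\<close>. It is meaningful for \<open>x, y \<in> M\<close> and \<open>t \<in> {0..1}\<close> in a space
  with unique geodesics; see \<open>geodesic_point_eq\<close> below.\<close>

definition geodesic_point :: "real \<Rightarrow> 'a \<Rightarrow> 'a \<Rightarrow> 'a" where
  "geodesic_point t x y = (THE p. \<exists>c. geodesic_joining c x y \<and> p = c t)"

definition nonexpansive :: "('a \<Rightarrow> 'a) \<Rightarrow> bool" where
  "nonexpansive T \<longleftrightarrow> (\<forall>x\<in>M. \<forall>y\<in>M. d (T x) (T y) \<le> d x y)"

definition mutually_firmly_nonexpansive ::
    "real \<Rightarrow> real \<Rightarrow> ('a \<Rightarrow> 'a) \<Rightarrow> ('a \<Rightarrow> 'a) \<Rightarrow> bool" where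
  "mutually_firmly_nonexpansive l m T U \<longleftrightarrow>
     (\<forall>x\<in>M. \<forall>y\<in>M. \<forall>\<alpha>\<in>{0..1}. \<forall>\<beta>\<in>{0..1}. (1 - \<alpha>) * l = (1 - \<beta>) * m \<longrightarrow>
        d (T x) (U y) \<le> d (geodesic_point \<alpha> x (T x)) (geodesic_point \<beta> y (U y)))"

text \<open>The family is indexed by the positive reals; \<open>T g\<close> for \<open>g \<le> 0\<close> plays no role.\<close>

definition jointly_firmly_nonexpansive :: "(real \<Rightarrow> 'a \<Rightarrow> 'a) \<Rightarrow> bool" where
  "jointly_firmly_nonexpansive T \<longleftrightarrow>
     (\<forall>l>0. \<forall>m>0. mutually_firmly_nonexpansive l m (T l) (T m))"

end

locale CAT0_space = Metric_space +
  assumes geodesic_exists: "\<lbrakk>x \<in> M; y \<in> M\<rbrakk> \<Longrightarrow> \<exists>c. geodesic_joining c x y"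
    and CAT0_ineq: "\<lbrakk>geodesic_joining c x y; z \<in> M; t \<in> {0..1}\<rbrakk> \<Longrightarrow>
      (d z (c t))\<^sup>2 \<le> (1 - t) * (d z (c 0))\<^sup>2 + t * (d z (c 1))\<^sup>2 - t * (1 - t) * (d (c 0) (c 1))\<^sup>2"
begin

lemma geodesic_unique:
  assumes c: "geodesic_joining c x y" and c': "geodesic_joining c' x y" and t: "t \<in> {0..1}"
  shows "c t = c' t"
proof -
  have in_M: "c t \<in> M" "c' t \<in> M"
    using c c' t unfolding geodesic_joining_def by blast+
  have ends: "c 0 = x" "c 1 = y" "c' 0 = x" "c' 1 = y"
    using c c' unfolding geodesic_joining_def by blast+
  have speed: "d (c' r) (c' s) = \<bar>r - s\<bar> * d x y" if "r \<in> {0..1}" "s \<in> {0..1}" for r s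
    using c' that unfolding geodesic_joining_def by blast
  have dist: "d (c' t) x = t * d x y" "d (c' t) y = (1 - t) * d x y"
    using speed[of t 0] speed[of t 1] t by (simp_all add: ends)
  have "(d (c' t) (c t))\<^sup>2 \<le>
      (1 - t) * (t * d x y)\<^sup>2 + t * ((1 - t) * d x y)\<^sup>2 - t * (1 - t) * (d x y)\<^sup>2"
    using CAT0_ineq[OF c in_M(2) t] by (simp only: ends dist)
  also have "\<dots> = 0"
    by algebra
  finally show ?thesis
    using in_M by simp
qed

lemma geodesic_point_eq:
  assumes "geodesic_joining c x y" "t \<in> {0..1}"
  shows "geodesic_point t x y = c t"
  unfolding geodesic_point_def
proof (rule the_equality)
  show "\<exists>c'. geodesic_joining c' x y \<and> c t = c' t"
    using assms(1) by blast
  show "p = c t" if "\<exists>c'. geodesic_joining c' x y \<and> p = c' t" for p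
    using that geodesic_unique[OF _ assms] by blast
qed

end

end

theory Submission
  imports Defs
begin

text \<open>Condition (ii) rewrites both \<open>T \<lambda> x\<close> and \<open>T \<mu> y\<close> as values of the single nonexpansive map
  \<open>T ((1 - \<alpha>) * \<lambda>) = T ((1 - \<beta>) * \<mu>)\<close> at the two geodesic points, unless \<open>\<alpha> = \<beta> = 1\<close>, where the
  inequality is trivial. Conversely, joint firm nonexpansiveness with \<open>\<alpha> = \<beta> = 0\<close> is (i), and
  with \<open>\<alpha> = t\<close>, \<open>\<beta> = 0\<close>, \<open>\<mu> = (1 - t) * \<gamma>\<close> and \<open>y = (1 - t) x + t T \<gamma> x\<close> its right-hand side
  is \<open>d y y = 0\<close>, which is (ii).\<close>

context CAT0_space
begin

lemma geodesic_point_in: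
  assumes "x \<in> M" "y \<in> M" "t \<in> {0..1}"
  shows "geodesic_point t x y \<in> M"
  using geodesic_exists[OF assms(1,2)] geodesic_point_eq[OF _ assms(3)] assms(3)
  by (metis Pi_iff geodesic_joining_def)

lemma geodesic_point_0: "\<lbrakk>x \<in> M; y \<in> M\<rbrakk> \<Longrightarrow> geodesic_point 0 x y = x"
  using geodesic_exists[of x y] geodesic_point_eq[of _ x y 0]
  by (auto simp: geodesic_joining_def)

lemma geodesic_point_1: "\<lbrakk>x \<in> M; y \<in> M\<rbrakk> \<Longrightarrow> geodesic_point 1 x y = y"
  using geodesic_exists[of x y] geodesic_point_eq[of _ x y 1]
  by (auto simp: geodesic_joining_def)

lemma jointly_firmly_nonexpansiveI:
  assumes T: "\<And>\<gamma>. \<gamma> > 0 \<Longrightarrow> T \<gamma> \<in> M \<rightarrow> M"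
    and nonexp: "\<And>\<gamma>. \<gamma> > 0 \<Longrightarrow> nonexpansive (T \<gamma>)"
    and resolvent: "\<And>\<gamma> t x. \<lbrakk>\<gamma> > 0; t \<in> {0..<1}; x \<in> M\<rbrakk> \<Longrightarrow>
      T ((1 - t) * \<gamma>) (geodesic_point t x (T \<gamma> x)) = T \<gamma> x"
  shows "jointly_firmly_nonexpansive T"
  unfolding jointly_firmly_nonexpansive_def mutually_firmly_nonexpansive_def
proof (intro allI impI ballI)
  fix l m :: real and x y and \<alpha> \<beta> :: real
  assume l: "l > 0" and m: "m > 0" and xy: "x \<in> M" "y \<in> M"
    and \<alpha>: "\<alpha> \<in> {0..1}" and \<beta>: "\<beta> \<in> {0..1}" and eq: "(1 - \<alpha>) * l = (1 - \<beta>) * m"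
  have T_in: "T l x \<in> M" "T m y \<in> M"
    using T l m xy by blast+
  let ?p = "geodesic_point \<alpha> x (T l x)" and ?q = "geodesic_point \<beta> y (T m y)"
  show "d (T l x) (T m y) \<le> d ?p ?q"
  proof (cases "\<alpha> = 1")
    case True
    \<comment> \<open>Here the constraint reads \<open>0 = (1 - \<beta>) * m\<close> with
      \<open>m > 0\<close>. Both geodesic points are then the endpoints \<open>T l x\<close> and
      \<open>T m y\<close>, so equality holds.\<close>
    then have "\<beta> = 1"
      using eq m by simp
    with True show ?thesis
      by (simp add: geodesic_point_1 xy T_in)
  next
    case False
    then have pos: "(1 - \<alpha>) * l > 0"
      using \<alpha> l by simp
    then have "\<beta> \<noteq> 1"
      using eq by auto
    \<comment> \<open>By \<open>eq\<close>, the index \<open>(1 - \<beta>) * m\<close> produced by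
      \<open>resolvent\<close> at \<open>y\<close> is the one produced at \<open>x\<close>, so a
      single map sends \<open>?p\<close> and \<open>?q\<close> to the two values.\<close>
    then have "T ((1 - \<alpha>) * l) ?p = T l x" "T ((1 - \<alpha>) * l) ?q = T m y"
      using resolvent[OF l _ xy(1), of \<alpha>] resolvent[OF m _ xy(2), of \<beta>] \<alpha> \<beta> False eq by auto
    moreover have "?p \<in> M" "?q \<in> M"
      using geodesic_point_in xy T_in \<alpha> \<beta> by blast+
    ultimately show ?thesis
      using nonexp[OF pos] unfolding nonexpansive_def by metis
  qed
qed

lemma jointly_firmly_nonexpansive_imp_nonexpansive:
  assumes "jointly_firmly_nonexpansive T" "\<gamma> > 0" "T \<gamma> \<in> M \<rightarrow> M"
  shows "nonexpansive (T \<gamma>)"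
  unfolding nonexpansive_def
proof (intro ballI)
  fix x y assume xy: "x \<in> M" "y \<in> M"
  then have "T \<gamma> x \<in> M" "T \<gamma> y \<in> M"
    using assms(3) by blast+
  \<comment> \<open>With both indices \<open>\<gamma>\<close> and both weights 0, the constraint is
    trivial.\<close>
  moreover have "d (T \<gamma> x) (T \<gamma> y) \<le>
      d (geodesic_point 0 x (T \<gamma> x)) (geodesic_point 0 y (T \<gamma> y))"
    using assms(1,2) xy
    unfolding jointly_firmly_nonexpansive_def mutually_firmly_nonexpansive_def by simp
  ultimately show "d (T \<gamma> x) (T \<gamma> y) \<le> d x y"
    by (simp add: geodesic_point_0 xy)
qed

lemma jointly_firmly_nonexpansive_imp_resolvent_identity:
  assumes jfn: "jointly_firmly_nonexpansive T" and T: "\<And>\<gamma>. \<gamma> > 0 \<Longrightarrow> T \<gamma> \<in> M \<rightarrow> M"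
    and "\<gamma> > 0" and t: "t \<in> {0..<1}" and x: "x \<in> M"
  shows "T ((1 - t) * \<gamma>) (geodesic_point t x (T \<gamma> x)) = T \<gamma> x"
proof -
  define m where "m = (1 - t) * \<gamma>"
  define y where "y = geodesic_point t x (T \<gamma> x)"
  have m: "m > 0"
    using \<open>\<gamma> > 0\<close> t by (simp add: m_def)
  have Tx: "T \<gamma> x \<in> M"
    using T \<open>\<gamma> > 0\<close> x by blast
  then have y: "y \<in> M"
    using t x by (simp add: y_def geodesic_point_in)
  then have Ty: "T m y \<in> M"
    using T m by blast
  \<comment> \<open>The weights \<open>t\<close> at \<open>x\<close> and 0 at \<open>y\<close> are
    admissible: \<open>m\<close> was chosen for this.\<close>
  have "(1 - t) * \<gamma> = (1 - 0) * m"
    by (simp add: m_def)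
  moreover have "t \<in> {0..1}" "(0::real) \<in> {0..1}"
    using t by auto
  ultimately have "d (T \<gamma> x) (T m y) \<le> d y (geodesic_point 0 y (T m y))"
    using jfn \<open>\<gamma> > 0\<close> m x y
    unfolding jointly_firmly_nonexpansive_def mutually_firmly_nonexpansive_def y_def by blast
  also have "\<dots> = 0"
    using y Ty by (simp add: geodesic_point_0)
  \<comment> \<open>Distance zero forces equality only for points of \<open>M\<close>, hence
    \<open>Tx\<close> and \<open>Ty\<close>.\<close>
  finally have "T \<gamma> x = T m y"
    using Tx Ty nonneg[of "T \<gamma> x" "T m y"] zero[of "T \<gamma> x" "T m y"] by linarith
  then show ?thesis
    by (simp add: m_def y_def)
qed

end

theorem theorem3p3:
  fixes M :: "'a set" and d :: "'a \<Rightarrow> 'a \<Rightarrow> real" and T :: "real \<Rightarrow> 'a \<Rightarrow> 'a"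
  assumes "CAT0_space M d"
    and "\<And>\<gamma>. \<gamma> > 0 \<Longrightarrow> T \<gamma> \<in> M \<rightarrow> M"
  shows "((\<forall>\<gamma>>0. Metric_space.nonexpansive M d (T \<gamma>)) \<and>
          (\<forall>\<gamma>>0. \<forall>t\<in>{0..<1}. \<forall>x\<in>M.
             T ((1 - t) * \<gamma>) (Metric_space.geodesic_point M d t x (T \<gamma> x)) = T \<gamma> x))
         \<longleftrightarrow> Metric_space.jointly_firmly_nonexpansive M d T"
proof -
  interpret CAT0_space M d
    by fact
  show ?thesis
    using jointly_firmly_nonexpansiveI[of T] jointly_firmly_nonexpansive_imp_nonexpansive[of T]
      jointly_firmly_nonexpansive_imp_resolvent_identity[of T] assms(2)
    by blast
qed

end
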